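(* Let $\mathcal{R}$ be an $R$-variety. The graph $\mathrm{G}(\mathcal{R})$ is a tree with root equal to $\Delta(\mathcal{R})$. Moreover, the set formed by the children of a vertex $S\in\mathcal{R}$ is $$\left\{S\setminus\{x\}\mid x \text{ is an element of the minimal } \mathcal{R}\text{-system of generators of } S \text{ and } x>\mathrm{F}_{\Delta(\mathcal{R})}(S)\right\}.$$
   Context: Let $\mathbb{N}$ be the set of nonnegative integers. A numerical semigroup is a subset $S\subseteq\mathbb{N}$ that is closed under addition, contains $0$, and has $\mathbb{N}\setminus S$ finite. If $S\subsetneq T$ are numerical semigroups, $\mathrm{F}_T(S)=\max(T\setminus S)$. An $R$-variety is a non-empty family $\mathcal{R}$ of numerical semigroups such that: (1) $\mathcal{R}$ has a maximum element with respect to inclusion, denoted $\Delta(\mathcal{R})$; (2) if $S,T\in\mathcal{R}$ then $S\cap T\in\mathcal{R}$; (3) if $S\in\mathcal{R}$ and $S\neq\Delta(\mathcal{R})$ then $S\cup\{\mathrm{F}_{\Delta(\mathcal{R})}(S)\}\in\mathcal{R}$. By convention $\mathrm{F}_{\Delta(\mathcal{R})}(\Delta(\mathcal{R}))=-1$. An $\mathcal{R}$-monoid is a submonoid of $(\mathbb{N},+)$ that is the intersection of a (non-empty, possibly infinite) family of elements of $\mathcal{R}$; in particular each element of $\mathcal{R}$ is an $\mathcal{R}$-monoid. For $A\subseteq\Delta(\mathcal{R})$, $\mathcal{R}(A)$ is the intersection of all $\mathcal{R}$-monoids containing $A$. If $M=\mathcal{R}(A)$, then $A$ is a minimal $\mathcal{R}$-system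 of generators of $M$ if $M\neq\mathcal{R}(B)$ for all $B\subsetneq A$. Every $\mathcal{R}$-monoid has a unique minimal $\mathcal{R}$-system of generators. A graph is a pair $(V,E)$ with $V\ne\emptyset$ and $E\subseteq\{(v,w)\in V\times V\mid v\neq w\}$. A path connecting $x$ and $y$ is a sequence of different edges $(v_0,v_1),(v_1,v_2),\dots,(v_{n-1},v_n)$ with $v_0=x$, $v_n=y$. A graph is a tree with root $r$ if for every vertex $x\neq r$ there is a unique path connecting $x$ and $r$. A vertex $x$ is a child of $y$ if $(x,y)$ is an edge. The graph $\mathrm{G}(\mathcal{R})$ has vertex set $\mathcal{R}$, and $(S,S')\in\mathcal{R}\times\mathcal{R}$ is an edge if and only if $S\neq\Delta(\mathcal{R})$ and $S'=S\cup\{\mathrm{F}_{\Delta(\mathcal{R})}(S)\}$. *)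

theory Defs
  imports "Graph_Theory.Pair_Digraph"
begin

definition nat_submonoid :: "nat set \<Rightarrow> bool" where
  "nat_submonoid M \<longleftrightarrow> 0 \<in> M \<and> (\<forall>a\<in>M. \<forall>b\<in>M. a + b \<in> M)"

definition numerical_semigroup :: "nat set \<Rightarrow> bool" where
  "numerical_semigroup S \<longleftrightarrow> nat_submonoid S \<and> finite (UNIV - S)"

text \<open>The relative Frobenius number \<open>F\<^sub>T(S)\<close>, meant for \<open>S \<subseteq> T\<close>. It is an integer because
  of the convention that its value is \<open>-1\<close> when \<open>S = T\<close>.\<close>

definition frobenius :: "nat set \<Rightarrow> nat set \<Rightarrow> int" where
  "frobenius T S = (if S = T then -1 else int (Max (T - S)))"

text \<open>The maximum element \<open>\<Delta>(\<R>)\<close>; the order on sets is inclusion.\<close>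

definition max_elt :: "nat set set \<Rightarrow> nat set" where
  "max_elt \<R> = (GREATEST S. S \<in> \<R>)"

text \<open>In the third closure condition, as in the edges of the graph below, \<open>S \<noteq> \<Delta>(\<R>)\<close> makes the
  Frobenius number nonnegative, so that \<open>nat\<close> is only a change of type.\<close>

definition R_variety :: "nat set set \<Rightarrow> bool" where
  "R_variety \<R> \<longleftrightarrow>
     \<R> \<noteq> {} \<and>
     (\<forall>S\<in>\<R>. numerical_semigroup S) \<and>
     (\<exists>D\<in>\<R>. \<forall>S\<in>\<R>. S \<subseteq> D) \<and>
     (\<forall>S\<in>\<R>. \<forall>T\<in>\<R>. S \<inter> T \<in> \<R>) \<and>
     (\<forall>S\<in>\<R>. S \<noteq> max_elt \<R> \<longrightarrow> S \<union> {nat (frobenius (max_elt \<R>) S)} \<in> \<R>)"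

definition R_monoid :: "nat set set \<Rightarrow> nat set \<Rightarrow> bool" where
  "R_monoid \<R> M \<longleftrightarrow> nat_submonoid M \<and> (\<exists>\<F>. \<F> \<noteq> {} \<and> \<F> \<subseteq> \<R> \<and> M = \<Inter>\<F>)"

text \<open>\<open>\<R>(A)\<close>, meant for \<open>A \<subseteq> \<Delta>(\<R>)\<close>.\<close>

definition R_generated :: "nat set set \<Rightarrow> nat set \<Rightarrow> nat set" where
  "R_generated \<R> A = \<Inter>{M. R_monoid \<R> M \<and> A \<subseteq> M}"

definition is_minimal_R_system :: "nat set set \<Rightarrow> nat set \<Rightarrow> nat set \<Rightarrow> bool" where
  "is_minimal_R_system \<R> M A \<longleftrightarrow>
     A \<subseteq> max_elt \<R> \<and> M = R_generated \<R> A \<and> (\<forall>B. B \<subset> A \<longrightarrow> M \<noteq> R_generated \<R> B)"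

text \<open>The definite description is justified by the fact that, for an R-variety, every R-monoid
  has exactly one minimal R-system of generators.\<close>

definition minimal_R_system :: "nat set set \<Rightarrow> nat set \<Rightarrow> nat set" where
  "minimal_R_system \<R> M = (THE A. is_minimal_R_system \<R> M A)"

text \<open>A graph has a nonempty vertex set and directed edges without loops, and may be infinite.
  A path is a consecutive sequence of pairwise different edges, which is called a trail in
  \<open>Arc_Walk\<close>; vertices may repeat.\<close>

definition rooted_tree :: "'a pair_pre_digraph \<Rightarrow> 'a \<Rightarrow> bool" where
  "rooted_tree G r \<longleftrightarrow>
     pair_loopfree_digraph G \<and> pverts G \<noteq> {} \<and> r \<in> pverts G \<and>
     (\<forall>x\<in>pverts G. x \<noteq> r \<longrightarrow> (\<exists>!p. pre_digraph.trail (with_proj G) x p r))"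

text \<open>Edges point from a child to its parent.\<close>

definition children :: "'a pair_pre_digraph \<Rightarrow> 'a \<Rightarrow> 'a set" where
  "children G y = {x. (x, y) \<in> parcs G}"

definition R_graph :: "nat set set \<Rightarrow> nat set pair_pre_digraph" where
  "R_graph \<R> =
     \<lparr> pverts = \<R>,
       parcs = {(S, S') \<in> \<R> \<times> \<R>.
         S \<noteq> max_elt \<R> \<and> S' = S \<union> {nat (frobenius (max_elt \<R>) S)}} \<rparr>"

end

theory Submission
  imports Defs
begin

text \<open>
  Let \<open>\<Delta>\<close> be the maximum of \<open>\<R>\<close>. Every \<open>S \<in> \<R>\<close> misses only finitely many elements of
  \<open>\<Delta>\<close>, and the only edge that leaves \<open>S \<noteq> \<Delta>\<close> adds the largest missing one. Following
  these edges fills the gaps one after the other and must end in \<open>\<Delta>\<close>, so a path to \<open>\<Delta>\<close>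
  exists; it is unique because no vertex has two outgoing edges and \<open>\<Delta>\<close> has none.

  For the children, let \<open>S\<close> be obtained from \<open>U\<close> by adding the largest gap \<open>x\<close> of \<open>U\<close>. Then
  \<open>U = S - {x}\<close> and all gaps of \<open>S\<close> are below \<open>x\<close>; conversely, if all gaps of \<open>S\<close> are below
  \<open>x \<in> S\<close>, then \<open>x\<close> is the largest gap of \<open>S - {x}\<close>. So the children of \<open>S\<close> are the sets
  \<open>S - {x} \<in> \<R>\<close> with \<open>x \<in> S\<close> above the Frobenius number of \<open>S\<close>, and it remains to see that,
  for \<open>x \<in> S\<close>, the condition \<open>S - {x} \<in> \<R>\<close> says exactly that \<open>x\<close> is a minimal generator
  (\<open>mem_minimal_R_system_iff\<close>).

  This rests on the description of the minimal system as the set \<open>A\<close> of those \<open>x \<in> S\<close> that the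
  other elements of \<open>S\<close> do not generate (\<open>minimal_R_system_eq\<close>). Every generating system clearly
  contains \<open>A\<close>; the point is that \<open>A\<close> itself generates \<open>S\<close>. The reason is
  that larger elements never help to generate \<open>x\<close> (\<open>mem_R_generated_smaller\<close>): a member of
  \<open>\<R>\<close> that avoids \<open>x\<close> can be enlarged by all elements of \<open>\<Delta>\<close> above \<open>x\<close>, one Frobenius number
  at a time, and still avoids \<open>x\<close>. Hence an \<open>x \<in> S - A\<close> is generated by the smaller elements of
  \<open>S\<close>, which allows induction on \<open>x\<close>.
\<close>

section \<open>Frobenius numbers in an R-variety\<close>

context
  fixes \<R> :: "nat set set"
  assumes variety: "R_variety \<R>"
begin

lemma max_elt_mem: "max_elt \<R> \<in> \<R>"
  and max_elt_upper: "S \<in> \<R> \<Longrightarrow> S \<subseteq> max_elt \<R>"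
proof -
  have "\<exists>D\<in>\<R>. \<forall>S\<in>\<R>. S \<subseteq> D"
    using variety by (simp only: R_variety_def)
  then obtain D where D: "D \<in> \<R>" "\<And>S. S \<in> \<R> \<Longrightarrow> S \<subseteq> D"
    by blast
  have "max_elt \<R> = D"
    unfolding max_elt_def using D by (rule Greatest_equality)
  then show "max_elt \<R> \<in> \<R>" "S \<in> \<R> \<Longrightarrow> S \<subseteq> max_elt \<R>"
    using D by simp_all
qed

lemma variety_Int: "S \<in> \<R> \<Longrightarrow> T \<in> \<R> \<Longrightarrow> S \<inter> T \<in> \<R>"
  using variety unfolding R_variety_def by blast

lemma finite_gaps: "S \<in> \<R> \<Longrightarrow> finite (T - S)"
  using variety unfolding R_variety_def numerical_semigroup_def
  by (intro finite_subset[of "T - S" "UNIV - S"]) auto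

lemma variety_R_monoid: "S \<in> \<R> \<Longrightarrow> R_monoid \<R> S"
  using variety unfolding R_variety_def numerical_semigroup_def R_monoid_def
  by (intro conjI exI[of _ "{S}"]) auto

lemma nat_frobenius:
  "S \<noteq> max_elt \<R> \<Longrightarrow> nat (frobenius (max_elt \<R>) S) = Max (max_elt \<R> - S)"
  by (simp add: frobenius_def)

lemma insert_Max_gap_mem:
  assumes "S \<in> \<R>" "S \<noteq> max_elt \<R>"
  shows "insert (Max (max_elt \<R> - S)) S \<in> \<R>"
proof -
  have "S \<union> {nat (frobenius (max_elt \<R>) S)} \<in> \<R>"
    using variety assms unfolding R_variety_def by blast
  then show ?thesis
    using nat_frobenius[OF assms(2)] by simp
qed

lemma Max_gap_mem:
  assumes "S \<in> \<R>" "S \<noteq> max_elt \<R>"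
  shows "Max (max_elt \<R> - S) \<in> max_elt \<R> - S"
  using assms finite_gaps max_elt_upper by (intro Max_in) auto

text \<open>The convention \<open>-1\<close> for \<open>S = \<Delta>(\<R>)\<close> is what makes this hold without exception: there is
  then no gap, and every natural number exceeds \<open>-1\<close>.\<close>

lemma frobenius_less_iff:
  assumes "S \<in> \<R>"
  shows "frobenius (max_elt \<R>) S < int x \<longleftrightarrow> (\<forall>y \<in> max_elt \<R> - S. y < x)"
proof (cases "S = max_elt \<R>")
  case False
  then have "max_elt \<R> - S \<noteq> {}"
    using max_elt_upper[OF assms] by blast
  then show ?thesis
    using False finite_gaps[OF assms, of "max_elt \<R>"] by (simp add: frobenius_def)
qed (simp add: frobenius_def)

text \<open>Passing from \<open>S\<close> to \<open>S \<union> {F(S)}\<close> lowers the number of gaps, so properties may be pulled back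
  along this step, starting from \<open>\<Delta>(\<R>)\<close>.\<close>

lemma gap_induct [consumes 1, case_names max step]:
  assumes "S \<in> \<R>"
    and "P (max_elt \<R>)"
    and "\<And>S. S \<in> \<R> \<Longrightarrow> S \<noteq> max_elt \<R> \<Longrightarrow> P (insert (Max (max_elt \<R> - S)) S) \<Longrightarrow> P S"
  shows "P S"
  using assms(1)
proof (induction "card (max_elt \<R> - S)" arbitrary: S rule: less_induct)
  case less
  show ?case
  proof (cases "S = max_elt \<R>")
    case False
    let ?m = "Max (max_elt \<R> - S)"
    have "max_elt \<R> - insert ?m S \<subset> max_elt \<R> - S"
      using Max_gap_mem[OF less.prems False] by blast
    then have "card (max_elt \<R> - insert ?m S) < card (max_elt \<R> - S)"
      using finite_gaps[OF less.prems] by (rule psubset_card_mono[rotated])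
    then show ?thesis
      using less insert_Max_gap_mem False assms(3) by blast
  qed (use assms(2) in simp)
qed

section \<open>Minimal systems of generators\<close>

text \<open>Every \<open>\<R>\<close>-monoid is an intersection of members of \<open>\<R>\<close>, and these are \<open>\<R>\<close>-monoids
  themselves; so intersecting over \<open>\<R>\<close> alone gives the same set, and non-membership in \<open>\<R>(A)\<close> is
  witnessed by a single member of \<open>\<R>\<close>.\<close>

lemma R_generated_eq: "R_generated \<R> A = \<Inter>{T \<in> \<R>. A \<subseteq> T}"
proof
  show "R_generated \<R> A \<subseteq> \<Inter>{T \<in> \<R>. A \<subseteq> T}"
    unfolding R_generated_def using variety_R_monoid by blast
  show "\<Inter>{T \<in> \<R>. A \<subseteq> T} \<subseteq> R_generated \<R> A"
    unfolding R_generated_def R_monoid_def by blast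
qed

lemma R_generated_self: "S \<in> \<R> \<Longrightarrow> R_generated \<R> S = S"
  unfolding R_generated_eq by blast

text \<open>As long as the largest gap exceeds \<open>x\<close>, it can be added without leaving \<open>\<R>\<close>; since \<open>x\<close> is
  a gap, the process stops exactly when \<open>x\<close> has become the largest one.\<close>

lemma fill_gaps_above:
  assumes "T \<in> \<R>" "x \<in> max_elt \<R> - T"
  shows "T \<union> {y \<in> max_elt \<R>. x < y} \<in> \<R>"
  using assms
proof (induction T rule: gap_induct)
  case (step S)
  let ?m = "Max (max_elt \<R> - S)"
  have m: "?m \<in> max_elt \<R> - S" "y \<in> max_elt \<R> - S \<Longrightarrow> y \<le> ?m" for y
    using step Max_gap_mem finite_gaps by auto
  show ?case
  proof (cases "?m = x")
    case True
    then have "S \<union> {y \<in> max_elt \<R>. x < y} = S"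
      using m(2) by force
    then show ?thesis using step by simp
  next
    case False
    then have "x < ?m" using m(2) step.prems by force
    then have "insert ?m S \<union> {y \<in> max_elt \<R>. x < y} = S \<union> {y \<in> max_elt \<R>. x < y}"
      using m(1) by blast
    then show ?thesis using step False by auto
  qed
qed simp

text \<open>A member of \<open>\<R>\<close> that separates \<open>x\<close> from the smaller elements of \<open>M\<close> also separates it from
  the larger ones, once these have been added.\<close>

lemma mem_R_generated_smaller:
  assumes "M \<subseteq> max_elt \<R>" "x \<in> M" "x \<in> R_generated \<R> (M - {x})"
  shows "x \<in> R_generated \<R> (M \<inter> {..<x})"
proof (rule ccontr)
  assume "x \<notin> R_generated \<R> (M \<inter> {..<x})"
  then obtain T where T: "T \<in> \<R>" "M \<inter> {..<x} \<subseteq> T" "x \<notin> T"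
    unfolding R_generated_eq by blast
  let ?T = "T \<union> {y \<in> max_elt \<R>. x < y}"
  have "?T \<in> \<R>"
    using fill_gaps_above T assms by blast
  moreover have "M - {x} \<subseteq> ?T"
    using T(2) assms(1) by force
  ultimately have "x \<in> ?T"
    using assms(3) unfolding R_generated_eq by blast
  then show False using T(3) by simp
qed

text \<open>The set on the right lies in every generating system \<open>B\<close> of \<open>S\<close>, since a \<open>B\<close> without \<open>x\<close>
  would generate \<open>x\<close> from \<open>S - {x}\<close>. It also generates \<open>S\<close>. Being the least generating system, it
  is the only minimal one.\<close>

lemma minimal_R_system_eq:
  assumes "S \<in> \<R>"
  shows "minimal_R_system \<R> S = {x \<in> S. x \<notin> R_generated \<R> (S - {x})}" (is "_ = ?A")
proof -
  have upper: "S \<subseteq> max_elt \<R>"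
    using assms by (rule max_elt_upper)
  have mono: "R_generated \<R> A \<subseteq> R_generated \<R> B" if "A \<subseteq> B" for A B
    using that unfolding R_generated_eq by blast
  have "R_generated \<R> ?A \<subseteq> S"
    using assms unfolding R_generated_eq by blast
  moreover have "x \<in> R_generated \<R> ?A" if "x \<in> S" for x
    using that
  proof (induction x rule: less_induct)
    case (less x)
    show ?case
    proof (cases "x \<in> ?A")
      case True
      then show ?thesis unfolding R_generated_eq by blast
    next
      case False
      then have "x \<in> R_generated \<R> (S \<inter> {..<x})"
        using mem_R_generated_smaller[OF upper less.prems] less.prems by blast
      moreover have "S \<inter> {..<x} \<subseteq> R_generated \<R> ?A"
        using less.IH by blast
      ultimately show ?thesis
        unfolding R_generated_eq by blast
    qed
  qed
  ultimately have gen: "S = R_generated \<R> ?A"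
    by blast
  have least: "?A \<subseteq> B" if "S = R_generated \<R> B" for B
  proof
    fix x assume x: "x \<in> ?A"
    have "B \<subseteq> S"
      using that unfolding R_generated_eq by blast
    then show "x \<in> B"
      using x that mono[of B "S - {x}"] by blast
  qed
  have "is_minimal_R_system \<R> S B \<longleftrightarrow> B = ?A" for B
    unfolding is_minimal_R_system_def using gen least upper by blast
  then show ?thesis
    unfolding minimal_R_system_def by (intro the_equality) simp_all
qed

text \<open>If \<open>T \<in> \<R>\<close> contains \<open>S - {x}\<close> but not \<open>x\<close>, then \<open>S - {x} = S \<inter> T\<close>, and \<open>\<R>\<close> is closed
  under intersection.\<close>

lemma mem_minimal_R_system_iff:
  assumes "S \<in> \<R>"
  shows "x \<in> minimal_R_system \<R> S \<longleftrightarrow> x \<in> S \<and> S - {x} \<in> \<R>"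
proof
  assume "x \<in> minimal_R_system \<R> S"
  then obtain T where T: "x \<in> S" "T \<in> \<R>" "S - {x} \<subseteq> T" "x \<notin> T"
    unfolding minimal_R_system_eq[OF assms] R_generated_eq by blast
  then have "S - {x} = S \<inter> T" by blast
  then show "x \<in> S \<and> S - {x} \<in> \<R>"
    using T variety_Int[OF assms] by simp
next
  assume "x \<in> S \<and> S - {x} \<in> \<R>"
  then show "x \<in> minimal_R_system \<R> S"
    using R_generated_self[of "S - {x}"] by (simp add: minimal_R_system_eq[OF assms])
qed

section \<open>Edges and children\<close>

lemma pverts_R_graph: "pverts (R_graph \<R>) = \<R>"
  by (simp add: R_graph_def)

lemma R_graph_arc_iff:
  "(S, S') \<in> parcs (R_graph \<R>) \<longleftrightarrow>
     S \<in> \<R> \<and> S \<noteq> max_elt \<R> \<and> S' = insert (Max (max_elt \<R> - S)) S"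
proof (cases "S = max_elt \<R>")
  case False
  then show ?thesis
    by (simp add: R_graph_def nat_frobenius) (blast intro: insert_Max_gap_mem)
qed (simp add: R_graph_def)

lemma R_graph_arc_source: "e \<in> parcs (R_graph \<R>) \<Longrightarrow> fst e \<noteq> max_elt \<R>"
  using R_graph_arc_iff[of "fst e" "snd e"] by simp

lemma children_R_graph:
  assumes "S \<in> \<R>"
  shows "children (R_graph \<R>) S =
    {S - {x} | x. x \<in> minimal_R_system \<R> S \<and> int x > frobenius (max_elt \<R>) S}"
proof (intro set_eqI iffI)
  fix U assume "U \<in> children (R_graph \<R>) S"
  then have U: "U \<in> \<R>" "U \<noteq> max_elt \<R>" "S = insert (Max (max_elt \<R> - U)) U"
    by (auto simp: children_def R_graph_arc_iff)
  define x where "x = Max (max_elt \<R> - U)"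
  have x: "x \<in> max_elt \<R> - U" "\<And>y. y \<in> max_elt \<R> - U \<Longrightarrow> y \<le> x"
    using U Max_gap_mem finite_gaps by (auto simp: x_def)
  have S: "S = insert x U" using U(3) by (simp add: x_def)
  have U_eq: "S - {x} = U"
    using S x(1) by simp
  moreover have "x \<in> minimal_R_system \<R> S"
    unfolding mem_minimal_R_system_iff[OF assms] U_eq using U(1) S by simp
  moreover have "y < x" if "y \<in> max_elt \<R> - S" for y
    using that x(2)[of y] S by (simp add: order.strict_iff_order)
  then have "int x > frobenius (max_elt \<R>) S"
    using frobenius_less_iff[OF assms] by simp
  ultimately show "U \<in> {S - {x} | x. x \<in> minimal_R_system \<R> S \<and> int x > frobenius (max_elt \<R>) S}"
    by blast
next
  fix U assume "U \<in> {S - {x} | x. x \<in> minimal_R_system \<R> S \<and> int x > frobenius (max_elt \<R>) S}"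
  then obtain x where x: "U = S - {x}" "x \<in> S" "U \<in> \<R>" "\<forall>y \<in> max_elt \<R> - S. y < x"
    using assms by (auto simp: mem_minimal_R_system_iff frobenius_less_iff)
  have "x \<in> max_elt \<R>"
    using x(2) max_elt_upper[OF assms] by blast
  then have "Max (max_elt \<R> - U) = x"
    using x finite_gaps[OF x(3)] by (intro Max_eqI) (auto intro: less_imp_le)
  then show "U \<in> children (R_graph \<R>) S"
    using x \<open>x \<in> max_elt \<R>\<close> by (auto simp: children_def R_graph_arc_iff insert_absorb)
qed

section \<open>Paths to the root\<close>

lemma pair_loopfree_digraph_R_graph: "pair_loopfree_digraph (R_graph \<R>)"
proof
  fix e assume e: "e \<in> parcs (R_graph \<R>)"
  then show "fst e \<in> pverts (R_graph \<R>)" "snd e \<in> pverts (R_graph \<R>)"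
    by (auto simp: R_graph_def)
  show "fst e \<noteq> snd e"
    using e R_graph_arc_iff[of "fst e" "snd e"] Max_gap_mem[of "fst e"] by auto
qed

interpretation G: pair_loopfree_digraph "R_graph \<R>"
  by (rule pair_loopfree_digraph_R_graph)

text \<open>Both walks must take the same first arc, because the arcs form the graph of a function. Neither
  can be a proper initial part of the other, because no arc leaves \<open>\<Delta>(\<R>)\<close>.\<close>

lemma awalk_to_max_unique:
  assumes "G.awalk S p (max_elt \<R>)" "G.awalk S q (max_elt \<R>)"
  shows "p = q"
  using assms
proof (induction p arbitrary: S q)
  case Nil
  then have "S = max_elt \<R>"
    by (simp add: G.awalk_Nil_iff)
  then show ?case
    using Nil.prems(2) R_graph_arc_source[of "hd q"]
    by (cases q) (simp_all add: G.awalk_Cons_iff)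
next
  case (Cons e p)
  have e: "e \<in> parcs (R_graph \<R>)" "S = fst e" "G.awalk (snd e) p (max_elt \<R>)"
    using Cons.prems(1) by (simp_all add: G.awalk_Cons_iff)
  then have "S \<noteq> max_elt \<R>"
    using R_graph_arc_source by simp
  then obtain f q' where q: "q = f # q'"
    using Cons.prems(2) by (cases q) (simp_all add: G.awalk_Nil_iff)
  then have f: "f \<in> parcs (R_graph \<R>)" "S = fst f" "G.awalk (snd f) q' (max_elt \<R>)"
    using Cons.prems(2) by (simp_all add: G.awalk_Cons_iff)
  have "f = e"
    using e(1,2) f(1,2) R_graph_arc_iff[of S "snd e"] R_graph_arc_iff[of S "snd f"]
    by (metis prod.collapse)
  then show ?case
    using Cons.IH e(3) f(3) q by simp
qed

text \<open>The bound on the sources of the arcs serves the induction: the new first arc starts in a proper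
  subset of all later sources, so it does not occur again and the walk remains a trail.\<close>

lemma trail_to_max_exists:
  assumes "S \<in> \<R>"
  shows "\<exists>p. G.trail S p (max_elt \<R>) \<and> (\<forall>e \<in> set p. S \<subseteq> fst e)"
  using assms
proof (induction S rule: gap_induct)
  case max
  then show ?case
    using max_elt_mem
    by (intro exI[of _ "[]"]) (simp add: G.trail_def G.awalk_Nil_iff pverts_R_graph)
next
  case (step S)
  let ?S' = "insert (Max (max_elt \<R> - S)) S"
  obtain p where p: "G.trail ?S' p (max_elt \<R>)" "\<And>e. e \<in> set p \<Longrightarrow> ?S' \<subseteq> fst e"
    using step.IH by blast
  have "(S, ?S') \<notin> set p"
    using p(2)[of "(S, ?S')"] Max_gap_mem[OF step.hyps] by (intro notI) simp
  moreover have "(S, ?S') \<in> parcs (R_graph \<R>)"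
    using step.hyps by (simp only: R_graph_arc_iff simp_thms)
  ultimately have "G.trail S ((S, ?S') # p) (max_elt \<R>)"
    using p(1) by (simp add: G.trail_def G.awalk_Cons_iff)
  moreover have "\<forall>e \<in> set ((S, ?S') # p). S \<subseteq> fst e"
    using p(2) by simp
  ultimately show ?case
    by blast
qed

lemma rooted_tree_R_graph: "rooted_tree (R_graph \<R>) (max_elt \<R>)"
  unfolding rooted_tree_def
proof (intro conjI ballI impI)
  show "pair_loopfree_digraph (R_graph \<R>)"
    by (rule pair_loopfree_digraph_R_graph)
  show "pverts (R_graph \<R>) \<noteq> {}" "max_elt \<R> \<in> pverts (R_graph \<R>)"
    using max_elt_mem by (auto simp: pverts_R_graph)
  fix S assume "S \<in> pverts (R_graph \<R>)"
  then have "S \<in> \<R>"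
    by (simp add: pverts_R_graph)
  then obtain p where p: "G.trail S p (max_elt \<R>)"
    using trail_to_max_exists by blast
  have "q = p" if "G.trail S q (max_elt \<R>)" for q
    using p that unfolding G.trail_def by (intro awalk_to_max_unique[of S]) simp_all
  with p show "\<exists>!p. G.trail S p (max_elt \<R>)"
    by (rule ex1I)
qed

end

theorem theorem4p2:
  fixes \<R> :: "nat set set"
  assumes "R_variety \<R>"
  shows "rooted_tree (R_graph \<R>) (max_elt \<R>) \<and>
    (\<forall>S\<in>\<R>. children (R_graph \<R>) S =
      {S - {x} | x. x \<in> minimal_R_system \<R> S \<and> int x > frobenius (max_elt \<R>) S})"
  using rooted_tree_R_graph[OF assms] children_R_graph[OF assms] by blast

end
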